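(* Let $(\hat P,\Delta\hat P)$ be an optimal solution of problem (RED) described in the context, with optimal Lagrange multipliers and the resulting prices $\pi^e_{m,t}$, $\pi^{u,\mathrm{up}}_{m,t}$, $\pi^{u,\mathrm{down}}_{m,t}$. Then the dispatch instruction $\hat P_{i,t}$ and the price signal $(\pi^e_{m,t},\pi^{u,\mathrm{up}}_{m,t},\pi^{u,\mathrm{down}}_{m,t})$ constitute a competitive partial equilibrium: energy is cleared by $\sum_i\hat P_{i,t}=\sum_md_{m,t}$ for all $t$, uncertainty and generation reserve are cleared by $\sum_i\Delta\hat P^k_{i,t}=\sum_m\hat\epsilon^k_{m,t}$ for all $t$ and $k\in\mathcal K$, and for every unit $i$, with $m$ the bus where it is located, $(\hat P_{i,t})_t$ is an optimal solution of the profit maximization problem $$(\mathrm{PMP}_i)\quad \max_{(P_{i,t})_t}\ \sum_t\Big(P_{i,t}\pi^e_{m,t}+\pi^{u,\mathrm{up}}_{m,t}Q^{\mathrm{up}}_{i,t}+\pi^{u,\mathrm{down}}_{m,t}Q^{\mathrm{down}}_{i,t}-C_i^P(P_{i,t})\Big)$$ subject, for all $t$, to $$\hat I_{i,t}P_i^{\min}\le P_{i,t}\le\hat I_{i,t}P_i^{\max},$$ $$P_{i,t}-P_{i,t-1}\le r_i^u(1-\hat y_{i,t})+P_i^{\min}\hat y_{i,t},\qquad -P_{i,t}+P_{i,t-1}\le r_i^d(1-\hat z_{i,t})+P_i^{\min}\hat z_{i,t},$$ $$Q^{\mathrm{up}}_{i,t}=\min\{\hat I_{i,t}P_i^{\max}-P_{i,t},\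 R_i^u(1-\hat y_{i,t})\},\qquad Q^{\mathrm{down}}_{i,t}=\max\{\hat I_{i,t}P_i^{\min}-P_{i,t},\ -R_i^d(1-\hat z_{i,t+1})\}.$$ In particular, a price-taking unit $i$ obtains its maximum profit by following the dispatch instruction $\hat P_{i,t}$.
   Context: Data. There are finitely many units $i$, buses $m$ ($N_D$ of them), lines $l$ and time intervals $t\in\{1,\dots,N_T\}$. $\mathcal G(m)$ is the set of units located at bus $m$ (each unit is at exactly one bus). Real data: loads $d_{m,t}$, line limits $F_l\ge 0$, shift factors $\Gamma_{l,m}$, capacities $0\le P_i^{\min}\le P_i^{\max}$, ramping limits $r_i^u,r_i^d\ge0$ between sequential intervals, ramping limits $R_i^u,R_i^d\ge 0$ for uncertainty accommodation, initial outputs $P_{i,0}$. The cost functions $C_i^P$ are convex and (piecewise) linear, so that (RED) below is a linear program. Unit commitment variables are fixed at binary values $\hat I_{i,t}$ (on/off), $\hat y_{i,t}$ (start-up), $\hat z_{i,t}$ (shut-down) ($\hat z_{i,N_T+1}$ is also given). $\mathcal K$ is a finite index set and $\hat\epsilon^k\in\mathbb R^{N_DN_T}$, $k\in\mathcal K$, are given uncertainty vectors (extreme points of the uncertainty set). Problem (RED): minimize $\sum_t\sum_i C_i^P(P_{i,t})$ over $P_{i,t}$ and $\Delta P^k_{i,t}$ subject to the following constraints (multiplier in parentheses), with $P^{\mathrm{inj}}_{m,t}:=\sum_{i\in\mathcal G(m)}P_{i,t}-d_{m,t}$ and $\Delta P^{\mathrm{inj},k}_{m,t}:=\sum_{i\in\mathcal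 G(m)}\Delta P^k_{i,t}-\hat\epsilon^k_{m,t}$: - $(\lambda_t)$ $\sum_iP_{i,t}=\sum_md_{m,t}$; - $(\bar\beta_{i,t})$ $P_{i,t}\le\hat I_{i,t}P_i^{\max}$; $(\underline\beta_{i,t})$ $-P_{i,t}\le-\hat I_{i,t}P_i^{\min}$; - $(\bar\alpha_{i,t})$ $P_{i,t}-P_{i,t-1}\le r_i^u(1-\hat y_{i,t})+P_i^{\min}\hat y_{i,t}$; $(\underline\alpha_{i,t})$ $-P_{i,t}+P_{i,t-1}\le r_i^d(1-\hat z_{i,t})+P_i^{\min}\hat z_{i,t}$; - $(\bar\eta_{l,t})$ $\sum_m\Gamma_{l,m}P^{\mathrm{inj}}_{m,t}\le F_l$; $(\underline\eta_{l,t})$ $-\sum_m\Gamma_{l,m}P^{\mathrm{inj}}_{m,t}\le F_l$; and for all $k\in\mathcal K$: - $(\lambda^k_t)$ $\sum_i\Delta P^k_{i,t}=\sum_m\hat\epsilon^k_{m,t}$; - $(\bar\beta^k_{i,t})$ $P_{i,t}+\Delta P^k_{i,t}\le\hat I_{i,t}P_i^{\max}$; $(\underline\beta^k_{i,t})$ $-P_{i,t}-\Delta P^k_{i,t}\le-\hat I_{i,t}P_i^{\min}$; - $(\bar\alpha^k_{i,t})$ $\Delta P^k_{i,t}\le R_i^u(1-\hat y_{i,t})$; $(\underline\alpha^k_{i,t})$ $-\Delta P^k_{i,t}\le R_i^d(1-\hat z_{i,t+1})$; - $(\bar\eta^k_{l,t})$ $\sum_m\Gamma_{l,m}(P^{\mathrm{inj}}_{m,t}+\Delta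 P^{\mathrm{inj},k}_{m,t})\le F_l$; $(\underline\eta^k_{l,t})$ $-\sum_m\Gamma_{l,m}(P^{\mathrm{inj}}_{m,t}+\Delta P^{\mathrm{inj},k}_{m,t})\le F_l$. The Lagrangian is the cost plus $\sum_t\lambda_t(\sum_md_{m,t}-\sum_iP_{i,t})$ plus $\sum_{k,t}\lambda^k_t(\sum_m\hat\epsilon^k_{m,t}-\sum_i\Delta P^k_{i,t})$ plus, for each inequality, its nonnegative multiplier times (left side minus right side). Multipliers are optimal dual (KKT) multipliers. Energy price (LMP): $\pi^e_{m,t}:=\lambda_t-\sum_l\Gamma_{l,m}(\bar\eta_{l,t}-\underline\eta_{l,t})-\sum_l\sum_{k\in\mathcal K}\Gamma_{l,m}(\bar\eta^k_{l,t}-\underline\eta^k_{l,t})$. Uncertainty marginal price (UMP) for $\hat\epsilon^k$: $\pi^{u,k}_{m,t}:=\lambda^k_t-\sum_l\Gamma_{l,m}(\bar\eta^k_{l,t}-\underline\eta^k_{l,t})$. Aggregated UMPs: $\pi^{u,\mathrm{up}}_{m,t}:=\sum_{k\in\mathcal K:\ \pi^{u,k}_{m,t}\ge0}\pi^{u,k}_{m,t}$ and $\pi^{u,\mathrm{down}}_{m,t}:=\sum_{k\in\mathcal K:\ \pi^{u,k}_{m,t}<0}\pi^{u,k}_{m,t}$. In $(\mathrm{PMP}_i)$ the prices and the commitment values are fixed (units are price takers) and $P_{i,0}$ is the given initial output; $Q^{\mathrm{up}}_{i,t},Q^{\mathrm{down}}_{i,t}$ are functions of the decision variable $P_{i,t}$.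 *)

theory Defs
  imports "HOL-Analysis.Analysis"
begin

text \<open>
  Units, buses, lines and uncertainty vectors are indexed by finite sets over arbitrary types, so
  that the set of lines or of uncertainty vectors may be empty; time intervals are the natural
  numbers \<open>1, \<dots>, horizon\<close>.
\<close>

record ('i, 'm, 'l, 'k) dispatch_data =
  units :: "'i set"
  buses :: "'m set"
  lines :: "'l set"
  scenarios :: "'k set"
  horizon :: nat
  bus_of :: "'i \<Rightarrow> 'm"
  load :: "'m \<Rightarrow> nat \<Rightarrow> real"
  flow_limit :: "'l \<Rightarrow> real"
  shift_factor :: "'l \<Rightarrow> 'm \<Rightarrow> real"
  Pmin :: "'i \<Rightarrow> real"
  Pmax :: "'i \<Rightarrow> real"
  ramp_up :: "'i \<Rightarrow> real"          (* r_i^u, between sequential intervals *)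
  ramp_down :: "'i \<Rightarrow> real"        (* r_i^d *)
  Ramp_up :: "'i \<Rightarrow> real"          (* R_i^u, for uncertainty accommodation *)
  Ramp_down :: "'i \<Rightarrow> real"        (* R_i^d *)
  P_init :: "'i \<Rightarrow> real"
  cost :: "'i \<Rightarrow> real \<Rightarrow> real"
  I_hat :: "'i \<Rightarrow> nat \<Rightarrow> real"
  y_hat :: "'i \<Rightarrow> nat \<Rightarrow> real"
  z_hat :: "'i \<Rightarrow> nat \<Rightarrow> real"
  eps_hat :: "'k \<Rightarrow> 'm \<Rightarrow> nat \<Rightarrow> real"

abbreviation periods :: "('i, 'm, 'l, 'k) dispatch_data \<Rightarrow> nat set" where
  "periods D \<equiv> {1..horizon D}"

definition units_at :: "('i, 'm, 'l, 'k) dispatch_data \<Rightarrow> 'm \<Rightarrow> 'i set" where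
  "units_at D m = {i \<in> units D. bus_of D i = m}"

text \<open>Finitely many breakpoints, affine on every closed interval with no breakpoint in its interior
  (hence continuous); affine functions are the case without breakpoints.\<close>

definition piecewise_linear :: "(real \<Rightarrow> real) \<Rightarrow> bool" where
  "piecewise_linear f \<longleftrightarrow>
     (\<exists>B. finite B \<and>
        (\<forall>x y. x \<le> y \<longrightarrow> {x<..<y} \<inter> B = {} \<longrightarrow>
           (\<exists>a b. \<forall>u\<in>{x..y}. f u = a * u + b)))"

definition valid_data :: "('i, 'm, 'l, 'k) dispatch_data \<Rightarrow> bool" where
  "valid_data D \<longleftrightarrow>
     finite (units D) \<and> finite (buses D) \<and> finite (lines D) \<and> finite (scenarios D) \<and>
     (\<forall>i\<in>units D. bus_of D i \<in> buses D) \<and>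
     (\<forall>l\<in>lines D. 0 \<le> flow_limit D l) \<and>
     (\<forall>i\<in>units D. 0 \<le> Pmin D i \<and> Pmin D i \<le> Pmax D i) \<and>
     (\<forall>i\<in>units D. 0 \<le> ramp_up D i \<and> 0 \<le> ramp_down D i \<and>
                  0 \<le> Ramp_up D i \<and> 0 \<le> Ramp_down D i) \<and>
     (\<forall>i\<in>units D. convex_on UNIV (cost D i) \<and> piecewise_linear (cost D i)) \<and>
     (\<forall>i\<in>units D. \<forall>t\<in>periods D. I_hat D i t \<in> {0, 1} \<and> y_hat D i t \<in> {0, 1}) \<and>
     (\<forall>i\<in>units D. \<forall>t\<in>{1..horizon D + 1}. z_hat D i t \<in> {0, 1})"


section \<open>Problem (RED)\<close>

text \<open>Dispatch \<open>P i t\<close> and re-dispatch \<open>dP k i t\<close>; only \<open>t \<ge> 1\<close> is read, the output before the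
  first interval is the datum \<open>P_init\<close>.\<close>

definition prev_output ::
    "('i, 'm, 'l, 'k) dispatch_data \<Rightarrow> 'i \<Rightarrow> (nat \<Rightarrow> real) \<Rightarrow> nat \<Rightarrow> real" where
  "prev_output D i p t = (if t = 1 then P_init D i else p (t - 1))"

definition P_inj ::
    "('i, 'm, 'l, 'k) dispatch_data \<Rightarrow> ('i \<Rightarrow> nat \<Rightarrow> real) \<Rightarrow> 'm \<Rightarrow> nat \<Rightarrow> real" where
  "P_inj D P m t = (\<Sum>i\<in>units_at D m. P i t) - load D m t"

definition dP_inj ::
    "('i, 'm, 'l, 'k) dispatch_data \<Rightarrow> ('k \<Rightarrow> 'i \<Rightarrow> nat \<Rightarrow> real) \<Rightarrow> 'k \<Rightarrow> 'm \<Rightarrow> nat \<Rightarrow> real" where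
  "dP_inj D dP k m t = (\<Sum>i\<in>units_at D m. dP k i t) - eps_hat D k m t"

text \<open>Left side minus right side of each inequality constraint, named after its multiplier.\<close>

definition g_beta_up where
  "g_beta_up D P i t = P i t - I_hat D i t * Pmax D i"

definition g_beta_dn where
  "g_beta_dn D P i t = - P i t - (- (I_hat D i t * Pmin D i))"

definition g_alpha_up where
  "g_alpha_up D P i t =
     P i t - prev_output D i (P i) t
       - (ramp_up D i * (1 - y_hat D i t) + Pmin D i * y_hat D i t)"

definition g_alpha_dn where
  "g_alpha_dn D P i t =
     - P i t + prev_output D i (P i) t
       - (ramp_down D i * (1 - z_hat D i t) + Pmin D i * z_hat D i t)"

definition g_eta_up where
  "g_eta_up D P l t =
     (\<Sum>m\<in>buses D. shift_factor D l m * P_inj D P m t) - flow_limit D l"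

definition g_eta_dn where
  "g_eta_dn D P l t =
     - (\<Sum>m\<in>buses D. shift_factor D l m * P_inj D P m t) - flow_limit D l"

definition gk_beta_up where
  "gk_beta_up D P dP k i t = P i t + dP k i t - I_hat D i t * Pmax D i"

definition gk_beta_dn where
  "gk_beta_dn D P dP k i t = - P i t - dP k i t - (- (I_hat D i t * Pmin D i))"

definition gk_alpha_up where
  "gk_alpha_up D dP k i t = dP k i t - Ramp_up D i * (1 - y_hat D i t)"

definition gk_alpha_dn where
  "gk_alpha_dn D dP k i t = - dP k i t - Ramp_down D i * (1 - z_hat D i (t + 1))"

definition gk_eta_up where
  "gk_eta_up D P dP k l t =
     (\<Sum>m\<in>buses D. shift_factor D l m * (P_inj D P m t + dP_inj D dP k m t)) - flow_limit D l"

definition gk_eta_dn where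
  "gk_eta_dn D P dP k l t =
     - (\<Sum>m\<in>buses D. shift_factor D l m * (P_inj D P m t + dP_inj D dP k m t)) - flow_limit D l"

definition energy_cleared ::
    "('i, 'm, 'l, 'k) dispatch_data \<Rightarrow> ('i \<Rightarrow> nat \<Rightarrow> real) \<Rightarrow> bool" where
  "energy_cleared D P \<longleftrightarrow>
     (\<forall>t\<in>periods D. (\<Sum>i\<in>units D. P i t) = (\<Sum>m\<in>buses D. load D m t))"

definition uncertainty_cleared ::
    "('i, 'm, 'l, 'k) dispatch_data \<Rightarrow> ('k \<Rightarrow> 'i \<Rightarrow> nat \<Rightarrow> real) \<Rightarrow> bool" where
  "uncertainty_cleared D dP \<longleftrightarrow>
     (\<forall>t\<in>periods D. \<forall>k\<in>scenarios D.
        (\<Sum>i\<in>units D. dP k i t) = (\<Sum>m\<in>buses D. eps_hat D k m t))"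

definition red_feasible ::
    "('i, 'm, 'l, 'k) dispatch_data \<Rightarrow> ('i \<Rightarrow> nat \<Rightarrow> real) \<Rightarrow> ('k \<Rightarrow> 'i \<Rightarrow> nat \<Rightarrow> real) \<Rightarrow> bool"
where
  "red_feasible D P dP \<longleftrightarrow>
     energy_cleared D P \<and>
     (\<forall>t\<in>periods D. \<forall>i\<in>units D.
        g_beta_up D P i t \<le> 0 \<and> g_beta_dn D P i t \<le> 0 \<and>
        g_alpha_up D P i t \<le> 0 \<and> g_alpha_dn D P i t \<le> 0) \<and>
     (\<forall>t\<in>periods D. \<forall>l\<in>lines D. g_eta_up D P l t \<le> 0 \<and> g_eta_dn D P l t \<le> 0) \<and>
     uncertainty_cleared D dP \<and>
     (\<forall>k\<in>scenarios D. \<forall>t\<in>periods D. \<forall>i\<in>units D.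
        gk_beta_up D P dP k i t \<le> 0 \<and> gk_beta_dn D P dP k i t \<le> 0 \<and>
        gk_alpha_up D dP k i t \<le> 0 \<and> gk_alpha_dn D dP k i t \<le> 0) \<and>
     (\<forall>k\<in>scenarios D. \<forall>t\<in>periods D. \<forall>l\<in>lines D.
        gk_eta_up D P dP k l t \<le> 0 \<and> gk_eta_dn D P dP k l t \<le> 0)"

definition total_cost :: "('i, 'm, 'l, 'k) dispatch_data \<Rightarrow> ('i \<Rightarrow> nat \<Rightarrow> real) \<Rightarrow> real" where
  "total_cost D P = (\<Sum>t\<in>periods D. \<Sum>i\<in>units D. cost D i (P i t))"

definition red_optimal ::
    "('i, 'm, 'l, 'k) dispatch_data \<Rightarrow> ('i \<Rightarrow> nat \<Rightarrow> real) \<Rightarrow> ('k \<Rightarrow> 'i \<Rightarrow> nat \<Rightarrow> real) \<Rightarrow> bool"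
where
  "red_optimal D P dP \<longleftrightarrow>
     is_arg_min (\<lambda>(P', dP'). total_cost D P') (\<lambda>(P', dP'). red_feasible D P' dP') (P, dP)"


section \<open>Lagrange multipliers\<close>

record ('i, 'l, 'k) multipliers =
  lam :: "nat \<Rightarrow> real"
  beta_up :: "'i \<Rightarrow> nat \<Rightarrow> real"
  beta_dn :: "'i \<Rightarrow> nat \<Rightarrow> real"
  alpha_up :: "'i \<Rightarrow> nat \<Rightarrow> real"
  alpha_dn :: "'i \<Rightarrow> nat \<Rightarrow> real"
  eta_up :: "'l \<Rightarrow> nat \<Rightarrow> real"
  eta_dn :: "'l \<Rightarrow> nat \<Rightarrow> real"
  lamk :: "'k \<Rightarrow> nat \<Rightarrow> real"
  betak_up :: "'k \<Rightarrow> 'i \<Rightarrow> nat \<Rightarrow> real"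
  betak_dn :: "'k \<Rightarrow> 'i \<Rightarrow> nat \<Rightarrow> real"
  alphak_up :: "'k \<Rightarrow> 'i \<Rightarrow> nat \<Rightarrow> real"
  alphak_dn :: "'k \<Rightarrow> 'i \<Rightarrow> nat \<Rightarrow> real"
  etak_up :: "'k \<Rightarrow> 'l \<Rightarrow> nat \<Rightarrow> real"
  etak_dn :: "'k \<Rightarrow> 'l \<Rightarrow> nat \<Rightarrow> real"

definition lagrangian ::
    "('i, 'm, 'l, 'k) dispatch_data \<Rightarrow> ('i, 'l, 'k) multipliers \<Rightarrow>
     ('i \<Rightarrow> nat \<Rightarrow> real) \<Rightarrow> ('k \<Rightarrow> 'i \<Rightarrow> nat \<Rightarrow> real) \<Rightarrow> real" where
  "lagrangian D M P dP =
     total_cost D P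
     + (\<Sum>t\<in>periods D. lam M t * ((\<Sum>m\<in>buses D. load D m t) - (\<Sum>i\<in>units D. P i t)))
     + (\<Sum>k\<in>scenarios D. \<Sum>t\<in>periods D.
          lamk M k t * ((\<Sum>m\<in>buses D. eps_hat D k m t) - (\<Sum>i\<in>units D. dP k i t)))
     + (\<Sum>t\<in>periods D. \<Sum>i\<in>units D.
          beta_up M i t * g_beta_up D P i t + beta_dn M i t * g_beta_dn D P i t
          + alpha_up M i t * g_alpha_up D P i t + alpha_dn M i t * g_alpha_dn D P i t)
     + (\<Sum>t\<in>periods D. \<Sum>l\<in>lines D.
          eta_up M l t * g_eta_up D P l t + eta_dn M l t * g_eta_dn D P l t)
     + (\<Sum>k\<in>scenarios D. \<Sum>t\<in>periods D. \<Sum>i\<in>units D.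
          betak_up M k i t * gk_beta_up D P dP k i t
          + betak_dn M k i t * gk_beta_dn D P dP k i t
          + alphak_up M k i t * gk_alpha_up D dP k i t
          + alphak_dn M k i t * gk_alpha_dn D dP k i t)
     + (\<Sum>k\<in>scenarios D. \<Sum>t\<in>periods D. \<Sum>l\<in>lines D.
          etak_up M k l t * gk_eta_up D P dP k l t
          + etak_dn M k l t * gk_eta_dn D P dP k l t)"

definition dual_feasible ::
    "('i, 'm, 'l, 'k) dispatch_data \<Rightarrow> ('i, 'l, 'k) multipliers \<Rightarrow> bool" where
  "dual_feasible D M \<longleftrightarrow>
     (\<forall>t\<in>periods D. \<forall>i\<in>units D.
        0 \<le> beta_up M i t \<and> 0 \<le> beta_dn M i t \<and> 0 \<le> alpha_up M i t \<and> 0 \<le> alpha_dn M i t) \<and>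
     (\<forall>t\<in>periods D. \<forall>l\<in>lines D. 0 \<le> eta_up M l t \<and> 0 \<le> eta_dn M l t) \<and>
     (\<forall>k\<in>scenarios D. \<forall>t\<in>periods D. \<forall>i\<in>units D.
        0 \<le> betak_up M k i t \<and> 0 \<le> betak_dn M k i t \<and>
        0 \<le> alphak_up M k i t \<and> 0 \<le> alphak_dn M k i t) \<and>
     (\<forall>k\<in>scenarios D. \<forall>t\<in>periods D. \<forall>l\<in>lines D. 0 \<le> etak_up M k l t \<and> 0 \<le> etak_dn M k l t)"

definition complementary_slackness ::
    "('i, 'm, 'l, 'k) dispatch_data \<Rightarrow> ('i, 'l, 'k) multipliers \<Rightarrow>
     ('i \<Rightarrow> nat \<Rightarrow> real) \<Rightarrow> ('k \<Rightarrow> 'i \<Rightarrow> nat \<Rightarrow> real) \<Rightarrow> bool" where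
  "complementary_slackness D M P dP \<longleftrightarrow>
     (\<forall>t\<in>periods D. \<forall>i\<in>units D.
        beta_up M i t * g_beta_up D P i t = 0 \<and> beta_dn M i t * g_beta_dn D P i t = 0 \<and>
        alpha_up M i t * g_alpha_up D P i t = 0 \<and> alpha_dn M i t * g_alpha_dn D P i t = 0) \<and>
     (\<forall>t\<in>periods D. \<forall>l\<in>lines D.
        eta_up M l t * g_eta_up D P l t = 0 \<and> eta_dn M l t * g_eta_dn D P l t = 0) \<and>
     (\<forall>k\<in>scenarios D. \<forall>t\<in>periods D. \<forall>i\<in>units D.
        betak_up M k i t * gk_beta_up D P dP k i t = 0 \<and>
        betak_dn M k i t * gk_beta_dn D P dP k i t = 0 \<and>
        alphak_up M k i t * gk_alpha_up D dP k i t = 0 \<and>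
        alphak_dn M k i t * gk_alpha_dn D dP k i t = 0) \<and>
     (\<forall>k\<in>scenarios D. \<forall>t\<in>periods D. \<forall>l\<in>lines D.
        etak_up M k l t * gk_eta_up D P dP k l t = 0 \<and>
        etak_dn M k l t * gk_eta_dn D P dP k l t = 0)"

text \<open>Stationarity at a point where the piecewise linear costs may have a kink: \<open>0\<close> is a
  subgradient, with respect to the decision variables, of the convex Lagrangian.\<close>

definition stationary ::
    "('i, 'm, 'l, 'k) dispatch_data \<Rightarrow> ('i, 'l, 'k) multipliers \<Rightarrow>
     ('i \<Rightarrow> nat \<Rightarrow> real) \<Rightarrow> ('k \<Rightarrow> 'i \<Rightarrow> nat \<Rightarrow> real) \<Rightarrow> bool" where
  "stationary D M P dP \<longleftrightarrow> (\<forall>P' dP'. lagrangian D M P dP \<le> lagrangian D M P' dP')"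

definition kkt_multipliers ::
    "('i, 'm, 'l, 'k) dispatch_data \<Rightarrow> ('i, 'l, 'k) multipliers \<Rightarrow>
     ('i \<Rightarrow> nat \<Rightarrow> real) \<Rightarrow> ('k \<Rightarrow> 'i \<Rightarrow> nat \<Rightarrow> real) \<Rightarrow> bool" where
  "kkt_multipliers D M P dP \<longleftrightarrow>
     red_feasible D P dP \<and> dual_feasible D M \<and>
     complementary_slackness D M P dP \<and> stationary D M P dP"


section \<open>Prices\<close>

definition energy_price ::
    "('i, 'm, 'l, 'k) dispatch_data \<Rightarrow> ('i, 'l, 'k) multipliers \<Rightarrow> 'm \<Rightarrow> nat \<Rightarrow> real" where
  "energy_price D M m t =
     lam M t
     - (\<Sum>l\<in>lines D. shift_factor D l m * (eta_up M l t - eta_dn M l t))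
     - (\<Sum>l\<in>lines D. \<Sum>k\<in>scenarios D. shift_factor D l m * (etak_up M k l t - etak_dn M k l t))"

definition ump ::
    "('i, 'm, 'l, 'k) dispatch_data \<Rightarrow> ('i, 'l, 'k) multipliers \<Rightarrow> 'k \<Rightarrow> 'm \<Rightarrow> nat \<Rightarrow> real" where
  "ump D M k m t =
     lamk M k t - (\<Sum>l\<in>lines D. shift_factor D l m * (etak_up M k l t - etak_dn M k l t))"

definition ump_up ::
    "('i, 'm, 'l, 'k) dispatch_data \<Rightarrow> ('i, 'l, 'k) multipliers \<Rightarrow> 'm \<Rightarrow> nat \<Rightarrow> real" where
  "ump_up D M m t = (\<Sum>k\<in>{k \<in> scenarios D. ump D M k m t \<ge> 0}. ump D M k m t)"

definition ump_down ::
    "('i, 'm, 'l, 'k) dispatch_data \<Rightarrow> ('i, 'l, 'k) multipliers \<Rightarrow> 'm \<Rightarrow> nat \<Rightarrow> real" where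
  "ump_down D M m t = (\<Sum>k\<in>{k \<in> scenarios D. ump D M k m t < 0}. ump D M k m t)"


section \<open>Profit maximization and competitive partial equilibrium\<close>

definition Q_up ::
    "('i, 'm, 'l, 'k) dispatch_data \<Rightarrow> 'i \<Rightarrow> (nat \<Rightarrow> real) \<Rightarrow> nat \<Rightarrow> real" where
  "Q_up D i p t = min (I_hat D i t * Pmax D i - p t) (Ramp_up D i * (1 - y_hat D i t))"

definition Q_down ::
    "('i, 'm, 'l, 'k) dispatch_data \<Rightarrow> 'i \<Rightarrow> (nat \<Rightarrow> real) \<Rightarrow> nat \<Rightarrow> real" where
  "Q_down D i p t =
     max (I_hat D i t * Pmin D i - p t) (- (Ramp_down D i * (1 - z_hat D i (t + 1))))"

definition pmp_feasible ::
    "('i, 'm, 'l, 'k) dispatch_data \<Rightarrow> 'i \<Rightarrow> (nat \<Rightarrow> real) \<Rightarrow> bool" where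
  "pmp_feasible D i p \<longleftrightarrow>
     (\<forall>t\<in>periods D.
        I_hat D i t * Pmin D i \<le> p t \<and> p t \<le> I_hat D i t * Pmax D i \<and>
        p t - prev_output D i p t
          \<le> ramp_up D i * (1 - y_hat D i t) + Pmin D i * y_hat D i t \<and>
        - p t + prev_output D i p t
          \<le> ramp_down D i * (1 - z_hat D i t) + Pmin D i * z_hat D i t)"

text \<open>The prices are arbitrary functions here: a unit takes them as given.\<close>

definition pmp_profit ::
    "('i, 'm, 'l, 'k) dispatch_data \<Rightarrow>
     ('m \<Rightarrow> nat \<Rightarrow> real) \<Rightarrow> ('m \<Rightarrow> nat \<Rightarrow> real) \<Rightarrow> ('m \<Rightarrow> nat \<Rightarrow> real) \<Rightarrow>
     'i \<Rightarrow> (nat \<Rightarrow> real) \<Rightarrow> real" where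
  "pmp_profit D price_e price_up price_dn i p =
     (\<Sum>t\<in>periods D.
        p t * price_e (bus_of D i) t
        + price_up (bus_of D i) t * Q_up D i p t
        + price_dn (bus_of D i) t * Q_down D i p t
        - cost D i (p t))"

definition pmp_optimal ::
    "('i, 'm, 'l, 'k) dispatch_data \<Rightarrow>
     ('m \<Rightarrow> nat \<Rightarrow> real) \<Rightarrow> ('m \<Rightarrow> nat \<Rightarrow> real) \<Rightarrow> ('m \<Rightarrow> nat \<Rightarrow> real) \<Rightarrow>
     'i \<Rightarrow> (nat \<Rightarrow> real) \<Rightarrow> bool" where
  "pmp_optimal D price_e price_up price_dn i p \<longleftrightarrow>
     is_arg_max (pmp_profit D price_e price_up price_dn i) (pmp_feasible D i) p"

definition competitive_partial_equilibrium ::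
    "('i, 'm, 'l, 'k) dispatch_data \<Rightarrow>
     ('m \<Rightarrow> nat \<Rightarrow> real) \<Rightarrow> ('m \<Rightarrow> nat \<Rightarrow> real) \<Rightarrow> ('m \<Rightarrow> nat \<Rightarrow> real) \<Rightarrow>
     ('i \<Rightarrow> nat \<Rightarrow> real) \<Rightarrow> ('k \<Rightarrow> 'i \<Rightarrow> nat \<Rightarrow> real) \<Rightarrow> bool" where
  "competitive_partial_equilibrium D price_e price_up price_dn P dP \<longleftrightarrow>
     energy_cleared D P \<and>
     uncertainty_cleared D dP \<and>
     (\<forall>i\<in>units D. pmp_optimal D price_e price_up price_dn i (P i))"

end

theory Submission
  imports Defs
begin

text \<open>
  For fixed multipliers the Lagrangian splits into one term per unit, in which the multipliers of
  the coupling constraints only enter through the prices at the bus of the unit. Stationarity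
  therefore makes \<open>(P i, dP _ i)\<close> minimize the Lagrangian of unit \<open>i\<close>. A plan \<open>p\<close> feasible for
  the profit maximization problem extends to a feasible point of the unit's constraints in (RED) by
  re-dispatching \<open>Q_up\<close> in the scenarios with nonnegative price and \<open>Q_down\<close> in the others; with
  this choice the redispatch revenue is exactly the reserve revenue of \<open>p\<close>. Conversely \<open>dP\<close> lies
  between \<open>Q_down\<close> and \<open>Q_up\<close> at \<open>P i\<close>, so its revenue is at most the reserve revenue. Weak duality
  and complementary slackness then compare the two profits.
\<close>

section \<open>Splitting the Lagrangian over units\<close>

definition unit_penalty where
  "unit_penalty D M P dP i t =
     beta_up M i t * g_beta_up D P i t + beta_dn M i t * g_beta_dn D P i t
     + alpha_up M i t * g_alpha_up D P i t + alpha_dn M i t * g_alpha_dn D P i t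
     + (\<Sum>k\<in>scenarios D.
          betak_up M k i t * gk_beta_up D P dP k i t
          + betak_dn M k i t * gk_beta_dn D P dP k i t
          + alphak_up M k i t * gk_alpha_up D dP k i t
          + alphak_dn M k i t * gk_alpha_dn D dP k i t)"

text \<open>The negative of the profit of a unit that is paid scenario by scenario for its
  redispatch, at the individual prices \<open>ump\<close>.\<close>

definition priced_cost where
  "priced_cost D M P dP i t =
     cost D i (P i t) - P i t * energy_price D M (bus_of D i) t
     - (\<Sum>k\<in>scenarios D. ump D M k (bus_of D i) t * dP k i t)"

definition unit_lagrangian where
  "unit_lagrangian D M P dP i =
     (\<Sum>t\<in>periods D. priced_cost D M P dP i t + unit_penalty D M P dP i t)"

text \<open>Lets the plan of one unit be replaced while the terms of all others stay fixed.\<close>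

lemma unit_lagrangian_cong:
  assumes "P i = P' i" "\<And>k. dP k i = dP' k i"
  shows "unit_lagrangian D M P dP i = unit_lagrangian D M P' dP' i"
  using assms
  by (simp add: unit_lagrangian_def priced_cost_def unit_penalty_def g_beta_up_def g_beta_dn_def
      g_alpha_up_def g_alpha_dn_def gk_beta_up_def gk_beta_dn_def gk_alpha_up_def gk_alpha_dn_def)

text \<open>Each unit sits at exactly one bus, so the sets \<open>units_at D m\<close> partition the
  units.\<close>

lemma sum_units_at:
  fixes c :: "'m \<Rightarrow> real" and x :: "'i \<Rightarrow> real"
    and D :: "('i, 'm, 'l, 'k) dispatch_data"
  assumes "valid_data D"
  shows "(\<Sum>m\<in>buses D. c m * (\<Sum>i\<in>units_at D m. x i)) = (\<Sum>i\<in>units D. c (bus_of D i) * x i)"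
proof -
  have "(\<Sum>m\<in>buses D. c m * (\<Sum>i\<in>units_at D m. x i)) =
      (\<Sum>m\<in>buses D. \<Sum>i\<in>{i \<in> units D. bus_of D i = m}. c (bus_of D i) * x i)"
    by (auto simp: units_at_def sum_distrib_left intro!: sum.cong)
  also have "\<dots> = (\<Sum>i\<in>units D. c (bus_of D i) * x i)"
    using assms by (intro sum.group) (auto simp: valid_data_def)
  finally show ?thesis .
qed

text \<open>The two limits of a line see the same flow with opposite signs, so \<open>u - v\<close>
  prices the flow and \<open>u + v\<close> the limit. Exchanging the sums over lines and units
  charges each unit at its own bus. Arbitrary \<open>x\<close> and \<open>e\<close> cover both the
  base flow and the scenario flows.\<close>

lemma line_charge:
  fixes w F :: "'l \<Rightarrow> real" and x :: "'i \<Rightarrow> real" and e :: "'m \<Rightarrow> real"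
    and D :: "('i, 'm, 'l, 'k) dispatch_data"
  assumes "valid_data D"
  shows "(\<Sum>l\<in>lines D.
      u l * ((\<Sum>m\<in>buses D. shift_factor D l m * ((\<Sum>i\<in>units_at D m. x i) - e m)) - F l)
      + v l * (- (\<Sum>m\<in>buses D. shift_factor D l m * ((\<Sum>i\<in>units_at D m. x i) - e m)) - F l))
    = (\<Sum>i\<in>units D. (\<Sum>l\<in>lines D. shift_factor D l (bus_of D i) * (u l - v l)) * x i)
      - (\<Sum>l\<in>lines D. (u l - v l) * (\<Sum>m\<in>buses D. shift_factor D l m * e m) + (u l + v l) * F l)"
    (is "?L = ?R")
proof -
  have inj: "(\<Sum>m\<in>buses D. shift_factor D l m * ((\<Sum>i\<in>units_at D m. x i) - e m)) =
      (\<Sum>i\<in>units D. shift_factor D l (bus_of D i) * x i)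
      - (\<Sum>m\<in>buses D. shift_factor D l m * e m)" for l
    by (simp add: right_diff_distrib sum_subtractf sum_units_at[OF assms])
  have "?L = (\<Sum>l\<in>lines D. (u l - v l) * (\<Sum>i\<in>units D. shift_factor D l (bus_of D i) * x i)
      - ((u l - v l) * (\<Sum>m\<in>buses D. shift_factor D l m * e m) + (u l + v l) * F l))"
    unfolding inj by (intro sum.cong) (auto simp: algebra_simps)
  also have "\<dots> = (\<Sum>l\<in>lines D. \<Sum>i\<in>units D. (u l - v l) * (shift_factor D l (bus_of D i) * x i))
      - (\<Sum>l\<in>lines D. (u l - v l) * (\<Sum>m\<in>buses D. shift_factor D l m * e m) + (u l + v l) * F l)"
    by (simp add: sum_subtractf sum_distrib_left)
  also have "(\<Sum>l\<in>lines D. \<Sum>i\<in>units D. (u l - v l) * (shift_factor D l (bus_of D i) * x i)) =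
      (\<Sum>i\<in>units D. (\<Sum>l\<in>lines D. shift_factor D l (bus_of D i) * (u l - v l)) * x i)"
    by (subst sum.swap) (simp add: sum_distrib_left sum_distrib_right mult_ac)
  finally show ?thesis .
qed

text \<open>The constant depends on the data and the multipliers but not on the dispatch, so it
  cancels when two points are compared.\<close>

lemma lagrangian_decomposition:
  fixes D :: "('i, 'm, 'l, 'k) dispatch_data" and M :: "('i, 'l, 'k) multipliers"
  assumes "valid_data D"
  obtains c where
    "\<And>P dP. lagrangian D M P dP = c + (\<Sum>i\<in>units D. unit_lagrangian D M P dP i)"
proof -
  let ?T = "periods D" and ?U = "units D" and ?K = "scenarios D"
  \<comment> \<open>\<open>e\<close> and \<open>ek\<close> are the congestion charges at the bus of
    the unit; \<open>a\<close> and \<open>b\<close> are the parts of the line terms that do not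
    involve the dispatch.\<close>
  define e where "e i t =
      (\<Sum>l\<in>lines D. shift_factor D l (bus_of D i) * (eta_up M l t - eta_dn M l t))" for i t
  define ek where "ek k i t =
      (\<Sum>l\<in>lines D. shift_factor D l (bus_of D i) * (etak_up M k l t - etak_dn M k l t))" for k i t
  define a where "a t = (\<Sum>l\<in>lines D. (eta_up M l t - eta_dn M l t) *
      (\<Sum>m\<in>buses D. shift_factor D l m * load D m t)
      + (eta_up M l t + eta_dn M l t) * flow_limit D l)" for t
  define b where "b k t = (\<Sum>l\<in>lines D. (etak_up M k l t - etak_dn M k l t) *
      (\<Sum>m\<in>buses D. shift_factor D l m * (load D m t + eps_hat D k m t))
      + (etak_up M k l t + etak_dn M k l t) * flow_limit D l)" for k t
  define c where "c = (\<Sum>t\<in>?T. lam M t * (\<Sum>m\<in>buses D. load D m t) - a t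
      + (\<Sum>k\<in>?K. lamk M k t * (\<Sum>m\<in>buses D. eps_hat D k m t) - b k t))"
  have "lagrangian D M P dP = c + (\<Sum>i\<in>?U. unit_lagrangian D M P dP i)" for P dP
  proof -
    let ?q = "\<lambda>i t. beta_up M i t * g_beta_up D P i t + beta_dn M i t * g_beta_dn D P i t
          + alpha_up M i t * g_alpha_up D P i t + alpha_dn M i t * g_alpha_dn D P i t"
    let ?qk = "\<lambda>k i t. betak_up M k i t * gk_beta_up D P dP k i t
          + betak_dn M k i t * gk_beta_dn D P dP k i t
          + alphak_up M k i t * gk_alpha_up D dP k i t
          + alphak_dn M k i t * gk_alpha_dn D dP k i t"
    have base: "(\<Sum>l\<in>lines D. eta_up M l t * g_eta_up D P l t + eta_dn M l t * g_eta_dn D P l t)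
        = (\<Sum>i\<in>?U. e i t * P i t) - a t" for t
      unfolding g_eta_up_def g_eta_dn_def P_inj_def a_def e_def by (rule line_charge[OF assms])
    \<comment> \<open>Merging the injections makes \<open>line_charge\<close> applicable with output
      \<open>P + dP\<close> and demand \<open>load + eps_hat\<close>.\<close>
    have inj: "P_inj D P m t + dP_inj D dP k m t =
        (\<Sum>i\<in>units_at D m. P i t + dP k i t) - (load D m t + eps_hat D k m t)" for k m t
      by (simp add: P_inj_def dP_inj_def sum.distrib)
    have scen: "(\<Sum>l\<in>lines D. etak_up M k l t * gk_eta_up D P dP k l t
          + etak_dn M k l t * gk_eta_dn D P dP k l t)
        = (\<Sum>i\<in>?U. ek k i t * (P i t + dP k i t)) - b k t" for k t
      unfolding gk_eta_up_def gk_eta_dn_def inj b_def ek_def by (rule line_charge[OF assms])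
    have price: "energy_price D M (bus_of D i) t = lam M t - e i t - (\<Sum>k\<in>?K. ek k i t)" for i t
      unfolding energy_price_def e_def ek_def by (subst sum.swap) simp
    have ump: "ump D M k (bus_of D i) t = lamk M k t - ek k i t" for k i t
      by (simp add: ump_def ek_def)
    \<comment> \<open>The charge \<open>ek k i t\<close> falls on \<open>P i t + dP k i t\<close>:
      the first part belongs to the energy price, the second to the price of scenario
      \<open>k\<close>.\<close>
    have unit: "priced_cost D M P dP i t + unit_penalty D M P dP i t =
        cost D i (P i t) - lam M t * P i t + e i t * P i t + ?q i t
        + (\<Sum>k\<in>?K. ek k i t * (P i t + dP k i t) - lamk M k t * dP k i t + ?qk k i t)" for i t
    proof -
      have "(\<Sum>k\<in>?K. ek k i t * (P i t + dP k i t) - lamk M k t * dP k i t + ?qk k i t)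
        = P i t * (\<Sum>k\<in>?K. ek k i t) - (\<Sum>k\<in>?K. (lamk M k t - ek k i t) * dP k i t)
          + (\<Sum>k\<in>?K. ?qk k i t)"
        by (simp only: sum_distrib_left[of "P i t"] sum_subtractf[symmetric]
            sum.distrib[symmetric]) (simp only: algebra_simps)
      then show ?thesis
        unfolding priced_cost_def unit_penalty_def price ump by (simp add: algebra_simps)
    qed
    have "lagrangian D M P dP =
        (\<Sum>t\<in>?T. (\<Sum>i\<in>?U. cost D i (P i t))
          + lam M t * ((\<Sum>m\<in>buses D. load D m t) - (\<Sum>i\<in>?U. P i t))
          + (\<Sum>k\<in>?K. lamk M k t * ((\<Sum>m\<in>buses D. eps_hat D k m t) - (\<Sum>i\<in>?U. dP k i t)))
          + (\<Sum>i\<in>?U. ?q i t) + ((\<Sum>i\<in>?U. e i t * P i t) - a t)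
          + (\<Sum>k\<in>?K. \<Sum>i\<in>?U. ?qk k i t)
          + (\<Sum>k\<in>?K. (\<Sum>i\<in>?U. ek k i t * (P i t + dP k i t)) - b k t))"
      unfolding lagrangian_def total_cost_def base scen
      by (simp only: sum.distrib sum.swap[of _ ?T ?K])
    also have "\<dots> = (\<Sum>t\<in>?T. lam M t * (\<Sum>m\<in>buses D. load D m t) - a t
          + (\<Sum>k\<in>?K. lamk M k t * (\<Sum>m\<in>buses D. eps_hat D k m t) - b k t)
          + (\<Sum>i\<in>?U. priced_cost D M P dP i t + unit_penalty D M P dP i t))"
      unfolding unit
      by (intro sum.cong refl)
        (simp add: sum.distrib sum_subtractf right_diff_distrib sum_distrib_left
          sum.swap[of _ ?U ?K])
    also have "\<dots> = c + (\<Sum>i\<in>?U. unit_lagrangian D M P dP i)"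
      unfolding c_def unit_lagrangian_def by (subst sum.swap[of _ ?T ?U]) (simp only: sum.distrib)
    finally show ?thesis .
  qed
  then show thesis by (rule that)
qed

text \<open>Stationarity compares with every point, feasible or not, so unit \<open>i\<close> may
  deviate alone even if this breaks the power balance; the terms of the other units cancel.\<close>

lemma unit_lagrangian_minimal:
  assumes valid: "valid_data D" and stat: "stationary D M P dP" and i: "i \<in> units D"
  shows "unit_lagrangian D M P dP i \<le> unit_lagrangian D M P' dP' i"
proof -
  obtain c where c: "\<And>P dP. lagrangian D M P dP = c + (\<Sum>i\<in>units D. unit_lagrangian D M P dP i)"
    using lagrangian_decomposition[OF valid] by blast
  define P1 where "P1 = P(i := P' i)"
  define dP1 where "dP1 k = (dP k)(i := dP' k i)" for k
  have fin: "finite (units D)"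
    using valid by (simp add: valid_data_def)
  have "(\<Sum>j\<in>units D. unit_lagrangian D M P dP j) \<le> (\<Sum>j\<in>units D. unit_lagrangian D M P1 dP1 j)"
    using stat c by (simp add: stationary_def)
  moreover have "unit_lagrangian D M P1 dP1 i = unit_lagrangian D M P' dP' i"
    by (rule unit_lagrangian_cong) (auto simp: P1_def dP1_def)
  moreover have "(\<Sum>j\<in>units D - {i}. unit_lagrangian D M P1 dP1 j) =
      (\<Sum>j\<in>units D - {i}. unit_lagrangian D M P dP j)"
    by (intro sum.cong refl unit_lagrangian_cong) (auto simp: P1_def dP1_def)
  ultimately show ?thesis
    by (simp add: sum.remove[OF fin i])
qed

section \<open>Reserve payments and feasible redispatch\<close>

lemma ump_aggregate:
  fixes D :: "('i, 'm, 'l, 'k) dispatch_data"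
  assumes "valid_data D"
  shows "ump_up D M m t * x + ump_down D M m t * y =
    (\<Sum>k\<in>scenarios D. ump D M k m t * (if ump D M k m t \<ge> 0 then x else y))"
proof -
  have "finite (scenarios D)"
    using assms by (simp add: valid_data_def)
  moreover have "{k \<in> scenarios D. ump D M k m t < 0} = scenarios D \<inter> - {k. ump D M k m t \<ge> 0}"
    "{k \<in> scenarios D. ump D M k m t \<ge> 0} = scenarios D \<inter> {k. ump D M k m t \<ge> 0}"
    by auto
  ultimately show ?thesis
    by (simp add: ump_up_def ump_down_def sum_distrib_right if_distrib sum.If_cases)
qed

text \<open>Brings the profit into the form of the unit Lagrangian: the aggregated prices sort the
  scenarios by the sign of \<open>ump\<close>, and the redispatch is chosen by the same
  sign.\<close>

lemma pmp_profit_eq: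
  assumes "valid_data D"
  shows "pmp_profit D (energy_price D M) (ump_up D M) (ump_down D M) i (P i) =
    - (\<Sum>t\<in>periods D. priced_cost D M P (\<lambda>k j t.
        if ump D M k (bus_of D j) t \<ge> 0 then Q_up D j (P j) t else Q_down D j (P j) t) i t)"
  unfolding pmp_profit_def priced_cost_def sum_negf[symmetric]
    ump_aggregate[OF assms, symmetric]
  by (intro sum.cong refl) simp

text \<open>Binary commitment values make the ramping terms nonnegative. Hence zero redispatch is
  possible and \<open>Q_down\<close> never exceeds \<open>Q_up\<close>.\<close>

lemma reserve_bounds:
  assumes "valid_data D" "pmp_feasible D i p" "i \<in> units D" "t \<in> periods D"
  shows "Q_down D i p t \<le> 0" "0 \<le> Q_up D i p t"
proof -
  have "y_hat D i t \<in> {0, 1}" "z_hat D i (t + 1) \<in> {0, 1}"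
    "0 \<le> Ramp_up D i" "0 \<le> Ramp_down D i"
    using assms by (auto simp: valid_data_def)
  then have "0 \<le> Ramp_up D i * (1 - y_hat D i t)" "0 \<le> Ramp_down D i * (1 - z_hat D i (t + 1))"
    by auto
  with assms(2,4) show "Q_down D i p t \<le> 0" "0 \<le> Q_up D i p t"
    by (auto simp: Q_up_def Q_down_def pmp_feasible_def)
qed

text \<open>The weak duality half: such a redispatch satisfies the unit's own constraints in (RED),
  so each term is a nonnegative multiplier times a nonpositive number.\<close>

lemma unit_penalty_nonpos:
  assumes valid: "valid_data D" and dual: "dual_feasible D M" and feas: "pmp_feasible D i (P i)"
    and i: "i \<in> units D" and t: "t \<in> periods D"
    and q: "\<And>k. k \<in> scenarios D \<Longrightarrow> dP k i t \<in> {Q_down D i (P i) t, Q_up D i (P i) t}"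
  shows "unit_penalty D M P dP i t \<le> 0"
proof -
  note Q = reserve_bounds[OF valid feas i t]
  have base: "g_beta_up D P i t \<le> 0" "g_beta_dn D P i t \<le> 0"
    "g_alpha_up D P i t \<le> 0" "g_alpha_dn D P i t \<le> 0"
    using feas t by (auto simp: pmp_feasible_def g_beta_up_def g_beta_dn_def g_alpha_up_def
        g_alpha_dn_def)
  have scen: "gk_beta_up D P dP k i t \<le> 0 \<and> gk_beta_dn D P dP k i t \<le> 0 \<and>
      gk_alpha_up D dP k i t \<le> 0 \<and> gk_alpha_dn D dP k i t \<le> 0" if "k \<in> scenarios D" for k
  proof -
    \<comment> \<open>The \<open>min\<close> and \<open>max\<close> in \<open>Q_up\<close> and
      \<open>Q_down\<close> combine capacity and ramping, so these two bounds amount to the four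
      scenario constraints.\<close>
    have "Q_down D i (P i) t \<le> dP k i t" "dP k i t \<le> Q_up D i (P i) t"
      using q[OF that] Q by auto
    then show ?thesis
      by (simp add: gk_beta_up_def gk_beta_dn_def gk_alpha_up_def gk_alpha_dn_def
          Q_up_def Q_down_def)
  qed
  show ?thesis
    unfolding unit_penalty_def using dual i t base scen
    by (intro add_nonpos_nonpos sum_nonpos mult_nonneg_nonpos) (auto simp: dual_feasible_def)
qed

theorem mainTheorem3:
  fixes D :: "('i, 'm, 'l, 'k) dispatch_data"
    and P :: "'i \<Rightarrow> nat \<Rightarrow> real" and dP :: "'k \<Rightarrow> 'i \<Rightarrow> nat \<Rightarrow> real"
    and M :: "('i, 'l, 'k) multipliers"
  assumes "valid_data D"
    and "red_optimal D P dP"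
    and "kkt_multipliers D M P dP"
  shows "competitive_partial_equilibrium D
           (energy_price D M) (ump_up D M) (ump_down D M) P dP"
proof -
  let ?profit = "pmp_profit D (energy_price D M) (ump_up D M) (ump_down D M)"
  \<comment> \<open>The plan is an argument because \<open>q\<close> is used twice: at
    \<open>P\<close> to bound the revenue of \<open>dP\<close>, and at a deviation to extend it to a
    feasible redispatch.\<close>
  define q where "q P = (\<lambda>k j t. if ump D M k (bus_of D j) t \<ge> 0
      then Q_up D j (P j) t else Q_down D j (P j) t)" for P :: "'i \<Rightarrow> nat \<Rightarrow> real"
  have feas: "red_feasible D P dP" and dual: "dual_feasible D M"
    and slack: "complementary_slackness D M P dP" and stat: "stationary D M P dP"
    using assms(3) by (auto simp: kkt_multipliers_def)
  have profit: "?profit i (P' i) = - (\<Sum>t\<in>periods D. priced_cost D M P' (q P') i t)" for i P'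
    unfolding q_def by (rule pmp_profit_eq[OF assms(1)])
  have "pmp_optimal D (energy_price D M) (ump_up D M) (ump_down D M) i (P i)"
    if i: "i \<in> units D" for i
  proof -
    have "pmp_feasible D i (P i)"
      using feas i by (auto simp: red_feasible_def pmp_feasible_def g_beta_up_def g_beta_dn_def
          g_alpha_up_def g_alpha_dn_def)
    moreover have "?profit i p \<le> ?profit i (P i)" if p: "pmp_feasible D i p" for p
    proof -
      \<comment> \<open>Only row \<open>i\<close> is read below; the other rows are fillers.\<close>
      define P' where "P' = P(i := p)"
      \<comment> \<open>The chain starts at minus the profit of \<open>P i\<close> and ends at minus
        the profit of \<open>p\<close>.\<close>
      have "(\<Sum>t\<in>periods D. priced_cost D M P (q P) i t)
          \<le> (\<Sum>t\<in>periods D. priced_cost D M P dP i t)"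
      proof (rule sum_mono)
        fix t assume t: "t \<in> periods D"
        have "ump D M k (bus_of D i) t * dP k i t \<le> ump D M k (bus_of D i) t * q P k i t"
          if k: "k \<in> scenarios D" for k
        proof -
          have "Q_down D i (P i) t \<le> dP k i t" "dP k i t \<le> Q_up D i (P i) t"
            using feas i t k
            by (auto simp: red_feasible_def gk_beta_up_def gk_beta_dn_def gk_alpha_up_def
                gk_alpha_dn_def Q_up_def Q_down_def algebra_simps)
          \<comment> \<open>A nonnegative price preserves the bound by \<open>Q_up\<close>; a
            negative one reverses the bound by \<open>Q_down\<close>.\<close>
          then show ?thesis
            by (auto simp: q_def intro: mult_left_mono mult_left_mono_neg)
        qed
        then show "priced_cost D M P (q P) i t \<le> priced_cost D M P dP i t"
          by (auto simp: priced_cost_def intro: sum_mono)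
      qed
      also have "\<dots> = unit_lagrangian D M P dP i"
      proof -
        \<comment> \<open>By complementary slackness every product vanishes.\<close>
        have "unit_penalty D M P dP i t = 0" if "t \<in> periods D" for t
          using slack i that unfolding complementary_slackness_def unit_penalty_def
          by (simp only: add_0_left sum.neutral_const cong: sum.cong)
        then show ?thesis
          by (simp add: unit_lagrangian_def)
      qed
      also have "\<dots> \<le> unit_lagrangian D M P' (q P') i"
        by (rule unit_lagrangian_minimal[OF assms(1) stat i])
      also have "\<dots> \<le> (\<Sum>t\<in>periods D. priced_cost D M P' (q P') i t)"
        unfolding unit_lagrangian_def
      proof (rule sum_mono)
        fix t assume "t \<in> periods D"
        then have "unit_penalty D M P' (q P') i t \<le> 0"
          using p by (intro unit_penalty_nonpos[OF assms(1) dual _ i]) (auto simp: P'_def q_def)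
        then show "priced_cost D M P' (q P') i t + unit_penalty D M P' (q P') i t
            \<le> priced_cost D M P' (q P') i t"
          by simp
      qed
      finally have "?profit i (P' i) \<le> ?profit i (P i)"
        by (simp add: profit)
      then show ?thesis
        by (simp add: P'_def)
    qed
    ultimately show ?thesis
      by (auto simp: pmp_optimal_def is_arg_max_def not_less)
  qed
  then show ?thesis
    using feas by (simp add: competitive_partial_equilibrium_def red_feasible_def)
qed

end
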